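(* For all integers $n\geq 1$, we have \[ \overline{\mathcal{EO}}(10n+r)\equiv 0 \pmod 2\quad\text{for } r\in\{2,4\}, \] and \[ \mathcal{EO}_u(10n+r)\equiv 0 \pmod 2\quad\text{for } r\in\{2,6\}. \]
   Context: For a positive integer $k$, let $f_k:=(q^k;q^k)_\infty=\prod_{i=1}^\infty(1-q^{ki})$ as a formal power series in $q$ (or for $|q|<1$). The integers $\overline{\mathcal{EO}}(n)$ and $\mathcal{EO}_u(n)$, $n\ge 0$, are given by the generating functions \[ \sum_{n=0}^\infty \overline{\mathcal{EO}}(n)q^n=\frac{f_4^3}{f_2^2},\qquad \sum_{n=0}^\infty \mathcal{EO}_u(n)q^n=\frac{f_4^2}{f_2^2}. \] (Combinatorially, $\overline{\mathcal{EO}}(n)$ counts partitions of $n$ in which each even part is less than each odd part and only the largest even part appears an odd number of times; the generating function above is a known theorem of Andrews and may be taken as the definition.) *)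

theory Defs
  imports "HOL-Analysis.Analysis" "HOL-Number_Theory.Cong"
begin

text \<open>The infinite product is taken in the metric (i.e. \<open>X\<close>-adic) topology of formal power series;
  lemma \<open>fk_has_prod\<close> below shows that it converges for all \<open>k \<ge> 1\<close>. The index \<open>i\<close> starts
  at 0 here, hence the exponent \<open>k * Suc i\<close>.\<close>

definition fk :: "nat \<Rightarrow> int fps" where
  "fk k = (\<Prod>i. 1 - fps_X ^ (k * Suc i))"

text \<open>There is no division on \<open>int fps\<close> in the library, since \<open>int\<close> is not a field. For a power
  series \<open>F\<close> with constant coefficient 1, \<open>fps_right_inverse F 1\<close> is the inverse of \<open>F\<close> over the
  integers; see lemmas \<open>EO_bar_gf\<close> and \<open>EO_u_gf\<close>.\<close>

definition EO_bar :: "nat \<Rightarrow> int" where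
  "EO_bar n = fps_nth (fk 4 ^ 3 * fps_right_inverse (fk 2 ^ 2) 1) n"

definition EO_u :: "nat \<Rightarrow> int" where
  "EO_u n = fps_nth (fk 4 ^ 2 * fps_right_inverse (fk 2 ^ 2) 1) n"

lemma fk_partial_coeff:
  assumes "k \<ge> 1" "n \<le> m"
  shows "fps_nth (\<Prod>i\<le>m. 1 - fps_X ^ (k * Suc i) :: int fps) n
       = fps_nth (\<Prod>i\<le>n. 1 - fps_X ^ (k * Suc i)) n"
  using \<open>n \<le> m\<close>
proof (induction m rule: dec_induct)
  case base
  show ?case by simp
next
  case (step l)
  have "n < 1 * Suc (Suc l)" using step.hyps by simp
  also have "\<dots> \<le> k * Suc (Suc l)"
    using \<open>k \<ge> 1\<close> by (rule mult_le_mono1)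
  finally have "fps_nth (P * (1 - fps_X ^ (k * Suc (Suc l)))) n = fps_nth P n" for P :: "int fps"
    by (simp only: right_diff_distrib mult_1_right fps_sub_nth fps_X_power_mult_right_nth
        if_True diff_0_right)
  thus ?case
    using step.IH by (simp only: prod.atMost_Suc)
qed

lemma fk_has_prod:
  assumes "k \<ge> 1"
  shows "(\<lambda>i. 1 - fps_X ^ (k * Suc i)) has_prod fk k"
    and "fps_nth (fk k) 0 = 1"
proof -
  define g :: "int fps" where
    "g = Abs_fps (\<lambda>n. fps_nth (\<Prod>i\<le>n. 1 - fps_X ^ (k * Suc i)) n)"
  have lim: "(\<lambda>m. \<Prod>i\<le>m. 1 - fps_X ^ (k * Suc i)) \<longlonglongrightarrow> g"
  proof (rule tendsto_fpsI)
    fix n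
    show "\<forall>\<^sub>F m in sequentially. fps_nth (\<Prod>i\<le>m. 1 - fps_X ^ (k * Suc i)) n = fps_nth g n"
      using eventually_ge_at_top[of n]
      unfolding g_def fps_nth_Abs_fps by eventually_elim (rule fk_partial_coeff[OF assms])
  qed
  have g0: "fps_nth g 0 = 1"
    using assms by (simp add: g_def)
  hence "g \<noteq> 0" by auto
  with lim have hp: "(\<lambda>i. 1 - fps_X ^ (k * Suc i)) has_prod g"
    unfolding has_prod_def raw_has_prod_def by simp
  hence "fk k = g"
    unfolding fk_def by (rule has_prod_unique[symmetric])
  with hp g0 show "(\<lambda>i. 1 - fps_X ^ (k * Suc i)) has_prod fk k" "fps_nth (fk k) 0 = 1"
    by simp_all
qed

lemma fk_2_inverse: "fps_right_inverse (fk 2 ^ 2) 1 * fk 2 ^ 2 = 1"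
proof -
  have "fk 2 ^ 2 * fps_right_inverse (fk 2 ^ 2) 1 = 1"
    by (rule fps_right_inverse) (simp add: fk_has_prod(2) fps_nth_power_0)
  thus ?thesis by (simp add: mult.commute)
qed

lemma EO_bar_gf: "Abs_fps EO_bar * fk 2 ^ 2 = fk 4 ^ 3"
proof -
  have "Abs_fps EO_bar = fk 4 ^ 3 * fps_right_inverse (fk 2 ^ 2) 1"
    by (rule fps_ext) (simp add: EO_bar_def)
  thus ?thesis by (simp only: mult.assoc fk_2_inverse mult_1_right)
qed

lemma EO_u_gf: "Abs_fps EO_u * fk 2 ^ 2 = fk 4 ^ 2"
proof -
  have "Abs_fps EO_u = fk 4 ^ 2 * fps_right_inverse (fk 2 ^ 2) 1"
    by (rule fps_ext) (simp add: EO_u_def)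
  thus ?thesis by (simp only: mult.assoc fk_2_inverse mult_1_right)
qed

end

theory Submission
  imports Defs
begin

text \<open>Modulo 2 one has \<open>f\<^sub>k\<^sup>2 \<equiv> f\<^sub>2\<^sub>k\<close>, so the two generating functions are congruent to \<open>f\<^sub>8\<close> and
  \<open>f\<^sub>4\<close>. By Euler's pentagonal number theorem \<open>f\<^sub>k\<close> is supported on \<open>k\<close> times the
  generalized pentagonal numbers, which only take the residues 0, 1, 2 modulo 5. The pentagonal number theorem is obtained from
  Shanks' finite identity, in which the summand \<open>s = 0\<close> is \<open>(q;q)\<^sub>n\<close> and all other summands are
  divisible by \<open>q\<^sup>n\<^sup>+\<^sup>1\<close>.\<close>

section \<open>Shanks' finite form of the pentagonal number theorem\<close>

text \<open>Induction on \<open>n\<close>: raising the upper index from \<open>m\<close> to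
  \<open>Suc m\<close> multiplies each old summand by \<open>q ^ s * (1 - q ^ Suc m)\<close>, and
  the resulting change telescopes to a single boundary term. With j = \<open>Suc s\<close> the
  exponents on the right are j(3j-1)/2 and j(3j+1)/2.\<close>

lemma shanks_identity:
  fixes q :: "'a::comm_ring_1"
  shows "(\<Sum>s\<le>n. (-1) ^ s * (\<Prod>i\<in>{s<..n}. 1 - q ^ i) * q ^ (s * n + \<Sum>{..s})) =
         1 + (\<Sum>s<n. (-1) ^ Suc s * (q ^ (Suc s * Suc s + \<Sum>{..s}) + q ^ (Suc s * Suc s + \<Sum>{..Suc s})))"
proof (induction n)
  case 0
  show ?case by simp
next
  case (Suc m)
  define a where "a s = (-1) ^ s * (\<Prod>i\<in>{s<..m}. 1 - q ^ i) * q ^ (s * m + \<Sum>{..s})" for s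
  \<comment> \<open>The correction left over at \<open>j\<close> is the part of
    \<open>a (Suc j)\<close> that its factor \<open>q ^ Suc j\<close> fails to provide; this drives
    the telescoping.\<close>
  have a_Suc: "a j * q ^ j * q ^ Suc m = - a (Suc j) * (1 - q ^ Suc j)" if "j < m" for j
  proof -
    have "{j<..m} = insert (Suc j) {Suc j<..m}"
      using that by auto
    hence "(\<Prod>i\<in>{j<..m}. 1 - q ^ i) = (1 - q ^ Suc j) * (\<Prod>i\<in>{Suc j<..m}. 1 - q ^ i)"
      by simp
    moreover have "Suc j * m + \<Sum>{..Suc j} = j * m + \<Sum>{..j} + j + Suc m"
      by simp
    ultimately show ?thesis
      unfolding a_def by (simp only: power_add power_Suc[of "- 1"]) (simp add: mult_ac)
  qed
  have telescope: "(\<Sum>s\<le>j. a s * q ^ s * (1 - q ^ Suc m)) = (\<Sum>s\<le>j. a s) - a j * q ^ j * q ^ Suc m"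
    if "j \<le> m" for j
    using that
  proof (induction j)
    case 0
    show ?case by (simp add: right_diff_distrib)
  next
    case (Suc j)
    hence "j < m" by simp
    have "a (Suc j) * q ^ Suc j * (1 - q ^ Suc m) =
        a (Suc j) + a j * q ^ j * q ^ Suc m - a (Suc j) * q ^ Suc j * q ^ Suc m"
      unfolding a_Suc[OF \<open>j < m\<close>] by (simp only: algebra_simps) simp
    with Suc show ?case
      by simp
  qed
  \<comment> \<open>The surviving boundary term is one of the two new pentagonal powers on the
    right; the other is the new summand \<open>s = Suc m\<close> on the left.\<close>
  have a_m: "a m * q ^ m * q ^ Suc m = (-1) ^ m * q ^ (Suc m * Suc m + \<Sum>{..m})"
  proof -
    have "Suc m * Suc m + \<Sum>{..m} = m * m + \<Sum>{..m} + m + Suc m"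
      by simp
    thus ?thesis
      unfolding a_def by (simp only: power_add) (simp add: mult_ac)
  qed
  have step: "(-1) ^ s * (\<Prod>i\<in>{s<..Suc m}. 1 - q ^ i) * q ^ (s * Suc m + \<Sum>{..s})
      = a s * q ^ s * (1 - q ^ Suc m)" if "s \<le> m" for s
  proof -
    have "{s<..Suc m} = insert (Suc m) {s<..m}"
      using that by auto
    hence "(\<Prod>i\<in>{s<..Suc m}. 1 - q ^ i) = (1 - q ^ Suc m) * (\<Prod>i\<in>{s<..m}. 1 - q ^ i)"
      by simp
    moreover have "s * Suc m + \<Sum>{..s} = s * m + \<Sum>{..s} + s"
      by simp
    ultimately show ?thesis
      unfolding a_def by (simp only: power_add) (simp add: mult_ac)
  qed
  have "(\<Sum>s\<le>Suc m. (-1) ^ s * (\<Prod>i\<in>{s<..Suc m}. 1 - q ^ i) * q ^ (s * Suc m + \<Sum>{..s}))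
      = (\<Sum>s\<le>m. a s * q ^ s * (1 - q ^ Suc m)) + (-1) ^ Suc m * q ^ (Suc m * Suc m + \<Sum>{..Suc m})"
    by (simp only: sum.atMost_Suc greaterThanAtMost_empty[OF order.refl] prod.empty mult_1_right)
       (intro arg_cong2[where f = "(+)"] sum.cong refl step, simp)
  also have "(\<Sum>s\<le>m. a s * q ^ s * (1 - q ^ Suc m)) =
      (\<Sum>s\<le>m. a s) - (-1) ^ m * q ^ (Suc m * Suc m + \<Sum>{..m})"
    by (simp only: telescope[OF order.refl] a_m)
  also have "(\<Sum>s\<le>m. a s) =
      1 + (\<Sum>s<m. (-1) ^ Suc s * (q ^ (Suc s * Suc s + \<Sum>{..s}) + q ^ (Suc s * Suc s + \<Sum>{..Suc s})))"
    unfolding a_def by (rule Suc.IH)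
  finally show ?case
    by (simp only: sum.lessThan_Suc distrib_left power_Suc[of "- 1"]) (simp only: algebra_simps
        mult_minus_left mult_1_left add_minus_cancel minus_add_cancel)
qed

section \<open>Support of the coefficients of \<open>fk k\<close>\<close>

lemma fk_nth:
  assumes "k \<ge> 1" "n \<le> m"
  shows "fps_nth (fk k) n = fps_nth (\<Prod>i\<le>m. 1 - fps_X ^ (k * Suc i)) n"
proof -
  have "(\<lambda>m. \<Prod>i\<le>m. 1 - fps_X ^ (k * Suc i)) \<longlonglongrightarrow> fk k"
    using has_prod_imp_tendsto[OF fk_has_prod(1)[OF assms(1)]] .
  hence "\<forall>\<^sub>F m in sequentially. fps_nth (\<Prod>i\<le>m. 1 - fps_X ^ (k * Suc i)) n = fps_nth (fk k) n"
    unfolding tendsto_fps_iff ..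
  then obtain l where "l \<ge> n" "fps_nth (\<Prod>i\<le>l. 1 - fps_X ^ (k * Suc i)) n = fps_nth (fk k) n"
    unfolding eventually_sequentially by (metis nle_le)
  thus ?thesis
    using assms fk_partial_coeff[of k n l] fk_partial_coeff[of k n m] by simp
qed

text \<open>Shanks' identity at \<open>q = fps_X ^ k\<close> leaves only pentagonal powers up to
  degree \<open>n\<close>. Doubling avoids the division in s(3s+1)/2 and s(3s-1)/2, and moving
  \<open>k * s\<close> to the left avoids truncated subtraction.\<close>

lemma fk_nth_nonzero_imp_pentagonal:
  assumes "k \<ge> 1" "fps_nth (fk k) n \<noteq> 0"
  obtains s where "2 * n = k * (s * (3 * s + 1))" | s where "2 * n + k * s = k * (s * (3 * s))"
proof -
  define q :: "int fps" where "q = fps_X ^ k"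
  \<comment> \<open>The upper index \<open>Suc n\<close> makes \<open>t 0\<close> exactly the
    partial product over \<open>{..n}\<close>, while \<open>s * Suc n\<close> already exceeds
    \<open>n\<close> for \<open>s\<close> at least 1.\<close>
  define t where "t s = (-1) ^ s * (\<Prod>i\<in>{s<..Suc n}. 1 - q ^ i) * q ^ (s * Suc n + \<Sum>{..s})" for s
  have q_pow: "q ^ e = fps_X ^ (k * e)" for e
    by (simp add: q_def power_mult)
  have t_high: "fps_nth (t s) n = 0" if "s \<in> {1..Suc n}" for s
  proof -
    have "1 * (1 * Suc n) \<le> k * (s * Suc n + \<Sum>{..s})"
      using that assms(1) by (intro mult_le_mono trans_le_add1) auto
    thus ?thesis
      unfolding t_def q_pow by (simp add: fps_X_power_mult_right_nth)
  qed
  have "{0<..Suc n} = Suc ` {..n}"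
    by (auto simp: image_iff) (metis Suc_le_D Suc_le_mono atMost_iff less_eq_Suc_le)
  hence "t 0 = (\<Prod>i\<le>n. 1 - q ^ Suc i)"
    by (simp add: t_def prod.reindex)
  hence t0: "fps_nth (t 0) n = fps_nth (fk k) n"
    using fk_nth[OF assms(1), of n n] by (simp only: q_pow)
  have "fps_nth (\<Sum>s\<le>Suc n. t s) n = fps_nth (t 0) n + (\<Sum>s\<in>{1..Suc n}. fps_nth (t s) n)"
    by (simp add: fps_sum_nth atMost_atLeast0 sum.atLeast_Suc_atMost)
  also have "\<dots> = fps_nth (fk k) n"
    using t_high by (simp add: t0)
  finally have "fps_nth (fk k) n = fps_nth (\<Sum>s\<le>Suc n. t s) n" ..
  also have "(\<Sum>s\<le>Suc n. t s) = 1 + (\<Sum>s<Suc n. (-1) ^ Suc s *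
      (q ^ (Suc s * Suc s + \<Sum>{..s}) + q ^ (Suc s * Suc s + \<Sum>{..Suc s})))"
    unfolding t_def by (rule shanks_identity)
  finally have nz: "fps_nth (1 + (\<Sum>s<Suc n. (-1) ^ Suc s *
      (q ^ (Suc s * Suc s + \<Sum>{..s}) + q ^ (Suc s * Suc s + \<Sum>{..Suc s})))) n \<noteq> 0"
    using assms(2) by simp
  have triangular: "2 * \<Sum>{..s} = s * Suc s" for s :: nat
    by (induction s) simp_all
  have sign: "fps_nth ((-1) ^ s * F) n = (-1) ^ s * fps_nth F n" for s and F :: "int fps"
    by (cases "even s") simp_all
  show thesis
  proof (cases "n = 0")
    case True
    thus ?thesis using that(1)[of 0] by simp
  next
    case False
    \<comment> \<open>For \<open>n\<close> nonzero the leading 1 contributes nothing, so some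
      summand must.\<close>
    with nz obtain s where "fps_nth ((-1) ^ Suc s *
      (q ^ (Suc s * Suc s + \<Sum>{..s}) + q ^ (Suc s * Suc s + \<Sum>{..Suc s}))) n \<noteq> 0"
      by (auto simp only: fps_add_nth fps_one_nth fps_sum_nth if_False add_0 elim!: sum.not_neutral_contains_not_neutral)
    hence "fps_nth (q ^ (Suc s * Suc s + \<Sum>{..s}) + q ^ (Suc s * Suc s + \<Sum>{..Suc s})) n \<noteq> 0"
      unfolding sign by auto
    hence "n = k * (Suc s * Suc s + \<Sum>{..s}) \<or> n = k * (Suc s * Suc s + \<Sum>{..Suc s})"
      unfolding q_pow by (auto simp only: fps_add_nth fps_X_power_nth split: if_splits)
    thus ?thesis
    proof
      assume n: "n = k * (Suc s * Suc s + \<Sum>{..s})"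
      have "2 * n + k * Suc s = k * (2 * (Suc s * Suc s) + 2 * \<Sum>{..s} + Suc s)"
        unfolding n by (simp only: algebra_simps)
      also have "\<dots> = k * (Suc s * (3 * Suc s))"
        unfolding triangular by (simp add: algebra_simps)
      finally show ?thesis by (rule that(2))
    next
      assume n: "n = k * (Suc s * Suc s + \<Sum>{..Suc s})"
      have "2 * n = k * (2 * (Suc s * Suc s) + 2 * \<Sum>{..Suc s})"
        unfolding n by (simp only: algebra_simps)
      also have "\<dots> = k * (Suc s * (3 * Suc s + 1))"
        unfolding triangular by (simp add: algebra_simps)
      finally show ?thesis by (rule that(1))
    qed
  qed
qed

section \<open>Reduction modulo 2\<close>

lemma two_dvd_fps_iff: "2 dvd F \<longleftrightarrow> (\<forall>n. 2 dvd fps_nth F n)" for F :: "int fps"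
proof
  assume "2 dvd F"
  then obtain G where "F = 2 * G" ..
  thus "\<forall>n. 2 dvd fps_nth F n"
    by (simp add: fps_numeral_fps_const)
next
  assume "\<forall>n. 2 dvd fps_nth F n"
  hence "F = 2 * Abs_fps (\<lambda>n. fps_nth F n div 2)"
    by (intro fps_ext) (simp add: fps_numeral_fps_const)
  thus "2 dvd F" ..
qed

text \<open>Factor by factor, (1-x)^2 - (1-x^2) = 2(x^2-x).\<close>

lemma two_dvd_prod_square_diff:
  fixes f :: "'b \<Rightarrow> 'a::comm_ring_1"
  shows "2 dvd (\<Prod>i\<in>A. 1 - f i) ^ 2 - (\<Prod>i\<in>A. 1 - f i ^ 2)"
proof (induction A rule: infinite_finite_induct)
  case (insert x A)
  define P where "P = (\<Prod>i\<in>A. 1 - f i)"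
  define Q where "Q = (\<Prod>i\<in>A. 1 - f i ^ 2)"
  from insert.IH obtain c where "P ^ 2 - Q = 2 * c"
    unfolding P_def Q_def ..
  hence P: "P ^ 2 = Q + 2 * c"
    by (simp add: algebra_simps)
  have "((1 - f x) * P) ^ 2 - (1 - f x ^ 2) * Q = (1 - f x) ^ 2 * P ^ 2 - (1 - f x ^ 2) * Q"
    by (simp add: power_mult_distrib)
  also have "\<dots> = 2 * ((1 - f x) ^ 2 * c + (f x ^ 2 - f x) * Q)"
    unfolding P by (simp add: algebra_simps power2_eq_square)
  finally show ?case
    using insert.hyps by (simp add: P_def Q_def)
qed simp_all

text \<open>Coefficient \<open>n\<close> on either side sees only the factors with index at most
  \<open>n\<close>, so the congruence for finite products suffices.\<close>

lemma two_dvd_fk_square_diff: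
  assumes "k \<ge> 1"
  shows "2 dvd fk k ^ 2 - fk (2 * k)"
  unfolding two_dvd_fps_iff
proof
  fix n
  define P :: "int fps" where "P = (\<Prod>i\<le>n. 1 - fps_X ^ (k * Suc i))"
  have "fps_nth (fk k ^ 2) n = fps_nth (P ^ 2) n"
    unfolding power2_eq_square fps_mult_nth P_def
    by (intro sum.cong refl arg_cong2[where f = "(*)"] fk_nth assms) auto
  moreover have "fps_nth (fk (2 * k)) n = fps_nth (\<Prod>i\<le>n. 1 - (fps_X ^ (k * Suc i)) ^ 2) n"
    using fk_nth[of "2 * k" n n] assms by (simp add: mult_ac flip: power_mult)
  moreover have "2 dvd fps_nth (P ^ 2 - (\<Prod>i\<le>n. 1 - (fps_X ^ (k * Suc i)) ^ 2)) n"
    using two_dvd_prod_square_diff[of "\<lambda>i. fps_X ^ (k * Suc i) :: int fps" "{..n}"]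
    unfolding two_dvd_fps_iff P_def ..
  ultimately show "2 dvd fps_nth (fk k ^ 2 - fk (2 * k)) n"
    by simp
qed

text \<open>Modulo 2, \<open>fk 2 ^ 2\<close> becomes \<open>fk 4\<close>, which has the inverse
  \<open>G\<close> over the integers and so cancels one factor on the right. Used with
  \<open>m = 2\<close> for \<open>EO_bar\<close> and \<open>m = 1\<close> for
  \<open>EO_u\<close>.\<close>

lemma quotient_fk_2_square_cong:
  assumes "E * fk 2 ^ 2 = fk 4 ^ Suc m"
  shows "2 dvd E - fk 4 ^ m"
proof -
  obtain G where G: "fk 4 * G = 1"
    using fps_right_inverse[of "fk 4" 1] fk_has_prod(2)[of 4] by auto
  have "2 dvd (fk 2 ^ 2 - fk 4) * (- (E * G))"
    by (rule dvd_mult2) (use two_dvd_fk_square_diff[of 2] in simp)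
  also have "(fk 2 ^ 2 - fk 4) * (- (E * G)) = E * (fk 4 * G) - (E * fk 2 ^ 2) * G"
    by (simp add: algebra_simps)
  also have "\<dots> = E * (fk 4 * G) - (fk 4 * G) * fk 4 ^ m"
    unfolding assms by (simp add: mult_ac)
  finally show ?thesis
    by (simp add: G)
qed

lemma EO_bar_parity: "2 dvd EO_bar n - fps_nth (fk 8) n"
proof -
  have "2 dvd Abs_fps EO_bar - fk 4 ^ 2"
    using EO_bar_gf by (intro quotient_fk_2_square_cong) (simp add: eval_nat_numeral)
  from dvd_add[OF this] two_dvd_fk_square_diff[of 4] have "2 dvd Abs_fps EO_bar - fk 8"
    by fastforce
  thus ?thesis
    unfolding two_dvd_fps_iff by simp
qed

lemma EO_u_parity: "2 dvd EO_u n - fps_nth (fk 4) n"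
proof -
  have "2 dvd Abs_fps EO_u - fk 4 ^ 1"
    using EO_u_gf by (intro quotient_fk_2_square_cong) (simp add: eval_nat_numeral)
  thus ?thesis
    unfolding two_dvd_fps_iff by simp
qed

section \<open>Residues modulo 5\<close>

text \<open>A check of the five residues of \<open>s\<close>. The term \<open>4 * s\<close> stands
  for -s modulo 5, so the second expression represents s(3s-1) without subtraction.\<close>

lemma pentagonal_mod_5:
  fixes s :: nat
  shows "s * (3 * s + 1) mod 5 \<in> {0, 2, 4}" "(s * (3 * s) + 4 * s) mod 5 \<in> {0, 2, 4}"
proof -
  define r where "r = s mod 5"
  have r: "[s = r] (mod 5)" "r \<in> {0, 1, 2, 3, 4}"
    unfolding r_def by (simp_all add: cong_def) auto
  have "[s * (3 * s + 1) = r * (3 * r + 1)] (mod 5)" "[s * (3 * s) + 4 * s = r * (3 * r) + 4 * r] (mod 5)"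
    by (intro cong_mult cong_add cong_refl r)+
  with r(2) show "s * (3 * s + 1) mod 5 \<in> {0, 2, 4}" "(s * (3 * s) + 4 * s) mod 5 \<in> {0, 2, 4}"
    by (auto simp: cong_def)
qed

lemma fk_nth_eq_0:
  assumes "k \<ge> 1" "2 * n mod 5 \<notin> {0, 2 * k mod 5, 4 * k mod 5}"
  shows "fps_nth (fk k) n = 0"
proof (rule ccontr)
  assume "fps_nth (fk k) n \<noteq> 0"
  with assms(1) obtain p where "p mod 5 \<in> {0, 2, 4}" "2 * n mod 5 = k * p mod 5"
  proof (cases rule: fk_nth_nonzero_imp_pentagonal)
    case (1 s)
    thus ?thesis using that pentagonal_mod_5(1) by metis
  next
    case (2 s)
    \<comment> \<open>Adding \<open>4 * (k * s)\<close> to both sides completes the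
      \<open>k * s\<close> on the left to a multiple of 5.\<close>
    hence "k * (s * (3 * s) + 4 * s) = 2 * n + 5 * (k * s)"
      by (simp add: distrib_left)
    hence "2 * n mod 5 = k * (s * (3 * s) + 4 * s) mod 5"
      by (metis mod_mult_self2)
    with that pentagonal_mod_5(2) show ?thesis by blast
  qed
  hence "2 * n mod 5 = k * (p mod 5) mod 5" "p mod 5 \<in> {0, 2, 4}"
    by (simp_all add: mod_mult_right_eq)
  with assms(2) show False
    by (auto simp: mult.commute)
qed

theorem theorem3p1:
  fixes n :: nat
  assumes "n \<ge> 1"
  shows "(\<forall>r\<in>{2, 4}. [EO_bar (10 * n + r) = 0] (mod 2)) \<and>
         (\<forall>r\<in>{2, 6}. [EO_u (10 * n + r) = 0] (mod 2))"
proof -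
  have residue: "2 * (10 * n + r) mod 5 = 2 * r mod 5" for r
  proof -
    have "2 * (10 * n + r) = 2 * r + 5 * (4 * n)"
      by simp
    thus ?thesis
      by (simp only: mod_mult_self2)
  qed
  \<comment> \<open>For \<open>k = 8\<close> the doubled exponents lie in {0, 1, 2} modulo 5,
    whereas \<open>2 * r\<close> gives 4 and 3; for \<open>k = 4\<close> they lie in {0, 1, 3},
    whereas \<open>2 * r\<close> gives 4 and 2.\<close>
  have "fps_nth (fk 8) (10 * n + r) = 0" if "r \<in> {2, 4}" for r
    using that by (intro fk_nth_eq_0) (auto simp only: residue, simp_all)
  moreover have "fps_nth (fk 4) (10 * n + r) = 0" if "r \<in> {2, 6}" for r
    using that by (intro fk_nth_eq_0) (auto simp only: residue, simp_all)
  ultimately show ?thesis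
    using EO_bar_parity EO_u_parity unfolding cong_0_iff by (metis diff_zero)
qed

end
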